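(* Let $G$ and $H$ be connected graphs, let $f:V(G)\to V(H)$ be any mapping, and let the girth of $G$ be equal to $c$. In any of the following cases: (i) $G$ is a tree and $H$ is a bridgeless graph; (ii) every edge of $H$ is contained in a cycle of length at most $c-1$; (iii) the mapping $f$ is locally injective and every edge of $H$ is contained in a cycle of length at most $2c-1$; the group $\tilde A(G,H,f)$ is equal to $\mathrm{Aut}(G\otimes_f H)$.
   Context: Graphs are undirected and simple. For graphs $G,H$ and a function $f:V(G)\to V(H)$, the Sierpiński product $G\otimes_f H$ is the graph with vertex set $V(G)\times V(H)$ and the following edges: the inner edges $\{(g,h),(g,h')\}$ for every $g\in V(G)$ and every $\{h,h'\}\in E(H)$; and the connecting edges $\{(g,f(g')),(g',f(g))\}$ for every $\{g,g'\}\in E(G)$. This partition of the edge set into inner and connecting edges is the fundamental edge partition. An automorphism of $G\otimes_f H$ respects the fundamental edge partition if it takes inner edges to inner edges and connecting edges to connecting edges. $\tilde A(G,H,f)$ denotes the group of all automorphisms of $G\otimes_f H$ that respect the fundamental edge partition. $f$ is locally injective if for every $g\in V(G)$ and all distinct $g_1,g_2\in N(g)$ (the set of neighbours of $g$) we have $f(g_1)\neq f(g_2)$. The girth is the length of a shortest cycle, and is $\infty$ for a graph without cycles. A graph is bridgeless if every edge lies on a cycle. *)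

theory Defs
  imports "Graph_Theory.Graph_Theory" "HOL-Algebra.Bij" "HOL-Library.Extended_Nat"
begin

text \<open>
  Simple undirected graphs, possibly infinite, are the loop-free symmetric pair digraphs
  (locale \<open>pair_bidirected_digraph\<close>): an undirected edge \<open>{u, v}\<close> is the pair of arcs
  \<open>(u, v)\<close>, \<open>(v, u)\<close>. In such a digraph the library's \<open>cycle\<close> also admits the closed walk
  \<open>u, v, u\<close>, which is not a cycle of an undirected graph, hence the length bound below. For the
  same reason the library's \<open>forest\<close> and \<open>tree\<close> are not used.
\<close>

definition ucycle :: "'a pair_pre_digraph \<Rightarrow> ('a \<times> 'a) awalk \<Rightarrow> bool" where
  "ucycle G p \<longleftrightarrow> pre_digraph.cycle (with_proj G) p \<and> 3 \<le> length p"

definition utree :: "'a pair_pre_digraph \<Rightarrow> bool" where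
  "utree G \<longleftrightarrow> Digraph_Component.connected (with_proj G) \<and> (\<nexists>p. ucycle G p)"

text \<open>The infimum of the empty set is \<open>\<infinity>\<close>, so a graph without cycles has girth \<open>\<infinity>\<close>.\<close>

definition girth :: "'a pair_pre_digraph \<Rightarrow> enat" where
  "girth G = (INF p \<in> {p. ucycle G p}. enat (length p))"

text \<open>
  A cycle can be traversed in either direction, so it does not matter which of the two arcs of an
  edge is required to occur in it.
\<close>

definition bridgeless :: "'a pair_pre_digraph \<Rightarrow> bool" where
  "bridgeless G \<longleftrightarrow> (\<forall>e \<in> parcs G. \<exists>p. ucycle G p \<and> e \<in> set p)"

definition edges_in_cycles_upto :: "'a pair_pre_digraph \<Rightarrow> enat \<Rightarrow> bool" where
  "edges_in_cycles_upto G k \<longleftrightarrow>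
     (\<forall>e \<in> parcs G. \<exists>p. ucycle G p \<and> e \<in> set p \<and> enat (length p) \<le> k)"

definition neighbours :: "'a pair_pre_digraph \<Rightarrow> 'a \<Rightarrow> 'a set" where
  "neighbours G g = {g'. (g, g') \<in> parcs G}"

definition locally_injective :: "'a pair_pre_digraph \<Rightarrow> ('a \<Rightarrow> 'b) \<Rightarrow> bool" where
  "locally_injective G f \<longleftrightarrow> (\<forall>g \<in> pverts G. inj_on f (neighbours G g))"

definition inner_edges ::
  "'a pair_pre_digraph \<Rightarrow> 'b pair_pre_digraph \<Rightarrow> (('a \<times> 'b) \<times> ('a \<times> 'b)) set" where
  "inner_edges G H = {((g, h), (g, h')) | g h h'. g \<in> pverts G \<and> (h, h') \<in> parcs H}"

definition connecting_edges ::
  "'a pair_pre_digraph \<Rightarrow> ('a \<Rightarrow> 'b) \<Rightarrow> (('a \<times> 'b) \<times> ('a \<times> 'b)) set" where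
  "connecting_edges G f = {((g, f g'), (g', f g)) | g g'. (g, g') \<in> parcs G}"

definition sierpinski_product ::
  "'a pair_pre_digraph \<Rightarrow> 'b pair_pre_digraph \<Rightarrow> ('a \<Rightarrow> 'b) \<Rightarrow> ('a \<times> 'b) pair_pre_digraph" where
  "sierpinski_product G H f =
     \<lparr> pverts = pverts G \<times> pverts H, parcs = inner_edges G H \<union> connecting_edges G f \<rparr>"

definition graph_auts :: "'a pair_pre_digraph \<Rightarrow> ('a \<Rightarrow> 'a) set" where
  "graph_auts G = {\<phi> \<in> Bij (pverts G).
     \<forall>u \<in> pverts G. \<forall>v \<in> pverts G. (\<phi> u, \<phi> v) \<in> parcs G \<longleftrightarrow> (u, v) \<in> parcs G}"

definition Aut :: "'a pair_pre_digraph \<Rightarrow> ('a \<Rightarrow> 'a) monoid" where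
  "Aut G = BijGroup (pverts G) \<lparr> carrier := graph_auts G \<rparr>"

definition respects_fundamental_partition ::
  "'a pair_pre_digraph \<Rightarrow> 'b pair_pre_digraph \<Rightarrow> ('a \<Rightarrow> 'b) \<Rightarrow> ('a \<times> 'b \<Rightarrow> 'a \<times> 'b) \<Rightarrow> bool" where
  "respects_fundamental_partition G H f \<phi> \<longleftrightarrow>
     (\<forall>(x, y) \<in> inner_edges G H. (\<phi> x, \<phi> y) \<in> inner_edges G H) \<and>
     (\<forall>(x, y) \<in> connecting_edges G f. (\<phi> x, \<phi> y) \<in> connecting_edges G f)"

definition Aut_fundamental ::
  "'a pair_pre_digraph \<Rightarrow> 'b pair_pre_digraph \<Rightarrow> ('a \<Rightarrow> 'b) \<Rightarrow> ('a \<times> 'b \<Rightarrow> 'a \<times> 'b) monoid" where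
  "Aut_fundamental G H f = BijGroup (pverts (sierpinski_product G H f))
     \<lparr> carrier := {\<phi> \<in> graph_auts (sierpinski_product G H f).
         respects_fundamental_partition G H f \<phi>} \<rparr>"

lemma pair_bidirected_digraph_sierpinski_product:
  assumes "pair_bidirected_digraph G" "pair_bidirected_digraph H" "f \<in> pverts G \<rightarrow> pverts H"
  shows "pair_bidirected_digraph (sierpinski_product G H f)"
proof -
  interpret G: pair_bidirected_digraph G by fact
  interpret H: pair_bidirected_digraph H by fact
  have Gs: "(v, u) \<in> parcs G" if "(u, v) \<in> parcs G" for u v
    using that G.pair_sym_arcs by (auto simp: symmetric_def dest: symD)
  have Hs: "(v, u) \<in> parcs H" if "(u, v) \<in> parcs H" for u v
    using that H.pair_sym_arcs by (auto simp: symmetric_def dest: symD)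
  note wf = G.arc_fst_in_verts G.arc_snd_in_verts H.arc_fst_in_verts H.arc_snd_in_verts
  let ?S = "sierpinski_product G H f"
  have f: "f g \<in> pverts H" if "g \<in> pverts G" for g
    using assms(3) that by (rule funcset_mem)
  have arcs: "parcs ?S = inner_edges G H \<union> connecting_edges G f"
    and verts: "pverts ?S = pverts G \<times> pverts H"
    by (simp_all add: sierpinski_product_def)
  have G1: "u \<in> pverts G" "v \<in> pverts G" "u \<noteq> v" if "(u, v) \<in> parcs G" for u v
    using G.arc_fst_in_verts[OF that] G.arc_snd_in_verts[OF that] G.pair_no_loops[OF that] by auto
  have H1: "u \<in> pverts H" "v \<in> pverts H" "u \<noteq> v" if "(u, v) \<in> parcs H" for u v
    using H.arc_fst_in_verts[OF that] H.arc_snd_in_verts[OF that] H.pair_no_loops[OF that] by auto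
  have wf: "fst e \<in> pverts ?S \<and> snd e \<in> pverts ?S \<and> fst e \<noteq> snd e" if e: "e \<in> parcs ?S" for e
  proof -
    consider (inner) g h h' where "e = ((g, h), (g, h'))" "g \<in> pverts G" "(h, h') \<in> parcs H"
      | (conn) g g' where "e = ((g, f g'), (g', f g))" "(g, g') \<in> parcs G"
      using e unfolding arcs inner_edges_def connecting_edges_def by blast
    then show ?thesis
    proof cases
      case inner
      with H1[OF inner(3)] show ?thesis by (simp add: verts)
    next
      case conn
      with G1[OF conn(2)] show ?thesis by (simp add: verts f)
    qed
  qed
  have "sym (inner_edges G H)" "sym (connecting_edges G f)"
    unfolding inner_edges_def connecting_edges_def sym_def using Gs Hs by blast+
  then have "sym (parcs ?S)"
    unfolding arcs by (rule sym_Un)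
  then have sym: "symmetric (with_proj ?S)" by (simp add: symmetric_def)
  show ?thesis
  proof (intro pair_bidirected_digraph.intro pair_sym_digraph.intro
      pair_loopfree_digraph.intro pair_wf_digraph.intro)
    show "pair_sym_digraph_axioms ?S" using sym by (rule pair_sym_digraph_axioms.intro)
    show "pair_loopfree_digraph_axioms ?S" using wf by (intro pair_loopfree_digraph_axioms.intro) blast
  qed (use wf in blast)+
qed

lemma subgroup_graph_auts: "subgroup (graph_auts G) (BijGroup (pverts G))"
proof -
  interpret B: group "BijGroup (pverts G)" by (rule group_BijGroup)
  show ?thesis
  proof (rule B.subgroupI)
    show "graph_auts G \<subseteq> carrier (BijGroup (pverts G))"
      by (auto simp: graph_auts_def BijGroup_def)
    show "graph_auts G \<noteq> {}"
    proof -
      have "(\<lambda>x\<in>pverts G. x) \<in> graph_auts G"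
        by (simp add: graph_auts_def id_Bij)
      then show ?thesis by blast
    qed
  next
    fix a assume a: "a \<in> graph_auts G"
    then have aB: "a \<in> Bij (pverts G)" by (simp add: graph_auts_def)
    then have bij: "bij_betw a (pverts G) (pverts G)" by (simp add: Bij_def)
    let ?b = "\<lambda>x\<in>pverts G. inv_into (pverts G) a x"
    have "(?b u, ?b v) \<in> parcs G \<longleftrightarrow> (u, v) \<in> parcs G" if "u \<in> pverts G" "v \<in> pverts G" for u v
    proof -
      have "?b u \<in> pverts G" "?b v \<in> pverts G" "a (?b u) = u" "a (?b v) = v"
        using that bij aB by (auto simp: Bij_inv_into_mem bij_betw_inv_into_right)
      moreover have "(a x, a y) \<in> parcs G \<longleftrightarrow> (x, y) \<in> parcs G"
        if "x \<in> pverts G" "y \<in> pverts G" for x y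
        using a that by (simp add: graph_auts_def)
      ultimately show ?thesis by metis
    qed
    then show "inv\<^bsub>BijGroup (pverts G)\<^esub> a \<in> graph_auts G"
      using restrict_inv_into_Bij[OF aB]
      by (simp add: inv_BijGroup[OF aB] graph_auts_def)
  next
    fix a b assume ab: "a \<in> graph_auts G" "b \<in> graph_auts G"
    then have B: "a \<in> Bij (pverts G)" "b \<in> Bij (pverts G)" by (simp_all add: graph_auts_def)
    have "b x \<in> pverts G" if "x \<in> pverts G" for x
      using Bij_imp_funcset[OF B(2)] that by (rule funcset_mem)
    then have "compose (pverts G) a b \<in> graph_auts G"
      using ab compose_Bij[OF B] by (simp add: graph_auts_def compose_def)
    then show "a \<otimes>\<^bsub>BijGroup (pverts G)\<^esub> b \<in> graph_auts G"
      using B by (simp add: BijGroup_def)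
  qed
qed

lemma group_Aut: "group (Aut G)"
  unfolding Aut_def by (rule group.subgroup_imp_group[OF group_BijGroup subgroup_graph_auts])

end

theory Submission
  imports Defs
begin

text \<open>
  Deleting the inner arcs of a cycle of the product and projecting the connecting ones to \<open>G\<close>
  gives a closed walk that uses every edge of \<open>G\<close> at most once, since an edge of \<open>G\<close> determines
  its connecting edge. So a cycle through a connecting edge has at least \<open>girth G\<close> connecting
  edges. If \<open>f\<close> is locally injective, the connecting edges form a matching, so that such a cycle
  has length at least \<open>2 * girth G\<close>. Inner edges lie on shorter cycles, and automorphisms preserve
  the length of cycles.
\<close>

section \<open>Walks and cycles as lists of arcs\<close>

lemma pcas_append_iff: "pcas u (p @ q) v \<longleftrightarrow> (\<exists>w. pcas u p w \<and> pcas w q v)"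
  by (induction p arbitrary: u) auto

text \<open>Every intermediate vertex is left as often as it is entered. For a closed walk this
  makes tails and heads equal as multisets, so the distinct heads of a cycle also give distinct
  tails.\<close>

lemma pcas_mset_ends:
  "pcas u p v \<Longrightarrow> add_mset v (mset (map fst p)) = add_mset u (mset (map snd p))"
proof (induction p arbitrary: u)
  case (Cons a p)
  then have "add_mset v (mset (map fst p)) = add_mset (snd a) (mset (map snd p))" by simp
  then show ?case using Cons.prems by (simp add: add_mset_commute)
qed simp

lemma pcas_last: "pcas u p v \<Longrightarrow> p \<noteq> [] \<Longrightarrow> v \<in> snd ` set p"
proof (induction p arbitrary: u)
  case (Cons a p)
  then show ?case by (cases "p = []") auto
qed simp

lemma pcas_map: "pcas u p v \<Longrightarrow> pcas (k u) (map (map_prod k k) p) (k v)"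
  by (induction p arbitrary: u) auto

lemma pawalk_verts_pcas: "pcas u p v \<Longrightarrow> pawalk_verts u p = u # map snd p"
  by (induction p arbitrary: u) auto

text \<open>The vertices of a walk after the first are the heads of its arcs, so distinctness
  concerns \<open>map snd p\<close> only. The base point is a vertex because the nonempty list
  starts with an arc at it.\<close>

lemma ucycle_iff:
  assumes "pair_wf_digraph G"
  shows "ucycle G p \<longleftrightarrow>
    set p \<subseteq> parcs G \<and> (\<exists>u. pcas u p u) \<and> distinct (map snd p) \<and> 3 \<le> length p"
proof -
  interpret pair_wf_digraph G by fact
  have "u \<in> pverts G" if "pcas u p u" "set p \<subseteq> parcs G" "p \<noteq> []" for u
    using that by (cases p) (auto dest: arc_fst_in_verts)
  then show ?thesis
    unfolding ucycle_def cycle_def awalk_def by (fastforce simp: pawalk_verts_pcas)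
qed

text \<open>Cutting the cycle at \<open>e\<close> and swapping the two pieces puts \<open>e\<close>
  in front. Equality of multisets keeps the length, the set of arcs and the number of crossing
  arcs.\<close>

lemma ucycle_mset_rotate:
  assumes "pair_wf_digraph G" "ucycle G p" "e \<in> set p"
  obtains q where "ucycle G (e # q)" "mset (e # q) = mset p"
proof -
  obtain p1 p2 where p: "p = p1 @ e # p2" using assms(3) by (meson split_list)
  obtain u where u: "pcas u p u" using assms by (auto simp: ucycle_iff)
  then obtain w where w: "pcas u p1 w" "pcas w (e # p2) u"
    unfolding p pcas_append_iff by blast
  then have "pcas w ((e # p2) @ p1) w" unfolding pcas_append_iff by blast
  then have "ucycle G (e # p2 @ p1)"
    using assms(2) by (auto simp: ucycle_iff[OF assms(1)] p simp del: pcas.simps)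
  moreover have "mset (e # p2 @ p1) = mset p" by (simp add: p)
  ultimately show ?thesis using that by blast
qed

text \<open>With \<open>(x, y)\<close> in front, the reverse arc would split the rest into closed
  walks at \<open>y\<close> and at \<open>x\<close>. A nonempty one would repeat \<open>y\<close> or
  \<open>x\<close> as a head, and if both are empty, the length is 2.\<close>

lemma ucycle_no_rev:
  assumes "pair_wf_digraph G" "ucycle G p" "(x, y) \<in> set p"
  shows "(y, x) \<notin> set p"
proof
  assume rev: "(y, x) \<in> set p"
  obtain q where q: "ucycle G ((x, y) # q)" "mset ((x, y) # q) = mset p"
    using ucycle_mset_rotate[OF assms] by blast
  have d: "distinct (map snd ((x, y) # q))" and len: "3 \<le> length ((x, y) # q)"
    using q assms(1) by (simp_all add: ucycle_iff)
  have walk: "pcas y q x" using q(1) assms(1) by (auto simp: ucycle_iff)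
  have "(y, x) \<in> set ((x, y) # q)" using rev mset_eq_setD[OF q(2)] by simp
  moreover have "x \<noteq> y" using walk d len by (cases q) (auto dest!: pcas_last)
  ultimately obtain q1 q2 where split: "q = q1 @ (y, x) # q2"
    by (auto dest: split_list)
  with walk have "pcas y q1 y" "pcas x q2 x" by (auto simp: pcas_append_iff)
  moreover have "y \<notin> snd ` set q1" "x \<notin> snd ` set q2" using d by (auto simp: split)
  ultimately have "q1 = []" "q2 = []" by (metis pcas_last)+
  with len show False by (simp add: split)
qed

section \<open>Connecting arcs of a cycle and their projection to \<open>G\<close>\<close>

definition crosses :: "('a \<times> 'b) \<times> ('a \<times> 'b) \<Rightarrow> bool" where
  "crosses a \<longleftrightarrow> fst (fst a) \<noteq> fst (snd a)"

definition base_walk :: "(('a \<times> 'b) \<times> ('a \<times> 'b)) list \<Rightarrow> ('a \<times> 'a) list" where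
  "base_walk p = map (map_prod fst fst) (filter crosses p)"

text \<open>An arc that does not cross keeps the first coordinate, so dropping it leaves no gap in
  the projected walk.\<close>

lemma pcas_base_walk: "pcas u p v \<Longrightarrow> pcas (fst u) (base_walk p) (fst v)"
  by (induction p arbitrary: u) (auto simp: base_walk_def crosses_def)

lemma inner_edges_not_crosses: "a \<in> inner_edges G H \<Longrightarrow> \<not> crosses a"
  by (auto simp: inner_edges_def crosses_def)

lemma connecting_edges_crosses:
  "pair_loopfree_digraph G \<Longrightarrow> a \<in> connecting_edges G f \<Longrightarrow> crosses a"
  by (auto simp: connecting_edges_def crosses_def dest: pair_loopfree_digraph.pair_no_loops)

lemma parcs_sierpinski_product:
  "parcs (sierpinski_product G H f) = inner_edges G H \<union> connecting_edges G f"
  by (simp add: sierpinski_product_def)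

lemma crossing_arc_connecting:
  "a \<in> parcs (sierpinski_product G H f) \<Longrightarrow> crosses a \<Longrightarrow> a \<in> connecting_edges G f"
  unfolding parcs_sierpinski_product using inner_edges_not_crosses by blast

lemma ucycle_in_base:
  assumes "pair_bidirected_digraph G" "pair_wf_digraph (sierpinski_product G H f)"
    and "ucycle (sierpinski_product G H f) p" "e \<in> set p" "e \<in> connecting_edges G f"
  obtains r where "ucycle G r" "length r \<le> length (filter crosses p)"
proof -
  interpret G: pair_bidirected_digraph G by fact
  let ?S = "sierpinski_product G H f"
  obtain g g' where e: "e = ((g, f g'), (g', f g))" and arc: "(g, g') \<in> parcs G"
    using assms(5) by (auto simp: connecting_edges_def)
  obtain q where q: "ucycle ?S (e # q)" "mset (e # q) = mset p"
    using ucycle_mset_rotate[OF assms(2-4)] by blast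
  have qS: "set q \<subseteq> parcs ?S" and walk: "pcas (snd e) q (fst e)"
    using q(1) assms(2) by (auto simp: ucycle_iff)
  have conn: "a \<in> connecting_edges G f" if "a \<in> set q" "crosses a" for a
    using crossing_arc_connecting qS that by blast
  have "set (base_walk q) \<subseteq> parcs G"
    using conn by (fastforce simp: base_walk_def connecting_edges_def)
  moreover have "pcas g' (base_walk q) g" using pcas_base_walk[OF walk] by (simp add: e)
  ultimately have base: "G.awalk g' (base_walk q) g"
    using arc by (auto simp: G.awalk_def dest: G.in_arcsD2)
  \<comment> \<open>Shortcutting the projected walk to a path from \<open>g'\<close> to
    \<open>g\<close> makes its heads distinct. The arc \<open>(g, g')\<close> below \<open>e\<close>
    then closes it to a cycle.\<close>
  define P where "P = G.awalk_to_apath (base_walk q)"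
  have P: "G.apath g' P g" unfolding P_def by (rule G.apath_awalk_to_apath[OF base])
  have sub: "set P \<subseteq> set (base_walk q)" unfolding P_def by (rule G.awalk_to_apath_subset[OF base])
  have PG: "set P \<subseteq> parcs G" and Pwalk: "pcas g' P g" and "distinct (pawalk_verts g' P)"
    using P by (auto simp: G.apath_def G.awalk_def)
  then have d: "distinct (g' # map snd P)" by (simp add: pawalk_verts_pcas)
  have "P \<noteq> []" using Pwalk G.pair_no_loops[OF arc] by auto
  \<comment> \<open>The only degenerate closure is going back along \<open>(g', g)\<close>. An arc
    of \<open>G\<close> determines its connecting arc, so this would force the reverse of
    \<open>e\<close> into the cycle.\<close>
  moreover have "(g', g) \<notin> set P"
  proof
    assume "(g', g) \<in> set P"
    then obtain a where a: "a \<in> set q" "crosses a" "map_prod fst fst a = (g', g)"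
      using sub by (auto simp: base_walk_def)
    then have "a = (snd e, fst e)" using conn[of a] by (auto simp: e connecting_edges_def)
    then show False
      using a(1) ucycle_no_rev[OF assms(2) q(1), of "fst e" "snd e"] by simp
  qed
  ultimately have "2 \<le> length P"
    using Pwalk by (cases P; cases "tl P") auto
  then have "ucycle G ((g, g') # P)"
    using PG Pwalk d arc by (auto simp: ucycle_iff[OF G.pair_wf_digraph_axioms])
  moreover have "length ((g, g') # P) \<le> length (filter crosses p)"
  proof -
    have "distinct P" using d by (simp add: distinct_map)
    then have "length P \<le> length (base_walk q)"
      using sub by (metis List.finite_set card_mono card_length distinct_card order_trans)
    moreover have "crosses e"
      using connecting_edges_crosses[OF G.pair_loopfree_digraph_axioms assms(5)] .
    \<comment> \<open>The crossing arcs of \<open>p\<close> are \<open>e\<close>, which pays for the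
      closing arc \<open>(g, g')\<close>, and those of \<open>q\<close>, which bound the length of
      \<open>P\<close>.\<close>
    moreover have "size (filter_mset crosses (mset (e # q))) = length (filter crosses p)"
      unfolding q(2) by (metis mset_filter size_mset)
    ultimately show ?thesis by (simp add: base_walk_def flip: mset_filter)
  qed
  ultimately show ?thesis using that by blast
qed

text \<open>A connecting arc at \<open>(g, h)\<close> leads to a vertex over a neighbour of
  \<open>g\<close> with \<open>f\<close>-value \<open>h\<close>. Local injectivity leaves only one
  such neighbour.\<close>

lemma connecting_edges_matching:
  assumes "pair_bidirected_digraph G" "locally_injective G f"
    and "(x, v) \<in> connecting_edges G f" "(v, y) \<in> connecting_edges G f"
  shows "x = y"
proof -
  interpret G: pair_bidirected_digraph G by fact
  obtain g1 g2 g where "x = (g1, f g)" "y = (g2, f g)" "v = (g, f g1)" "f g1 = f g2"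
    and "(g1, g) \<in> parcs G" "(g, g2) \<in> parcs G"
    using assms(3,4) by (auto simp: connecting_edges_def)
  moreover from this have "g1 \<in> neighbours G g" "g2 \<in> neighbours G g" "g \<in> pverts G"
    using G.arcs_symmetric[of g1 g] by (auto simp: neighbours_def dest: G.in_arcsD1)
  ultimately show ?thesis using assms(2) by (auto simp: locally_injective_def dest: inj_onD)
qed

text \<open>In a matching, consecutive crossing arcs would be reverses of each other, which a cycle
  excludes. Hence the tails and heads of the crossing arcs are pairwise different vertices of the
  cycle, two for each arc.\<close>

lemma twice_crossings_le_length:
  assumes "pair_bidirected_digraph G" "pair_wf_digraph (sierpinski_product G H f)"
    and "locally_injective G f" "ucycle (sierpinski_product G H f) p"
  shows "2 * length (filter crosses p) \<le> length p"
proof -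
  let ?S = "sierpinski_product G H f" and ?K = "set (filter crosses p)"
  obtain u where "pcas u p u" and pS: "set p \<subseteq> parcs ?S" and d: "distinct (map snd p)"
    using assms(4) unfolding ucycle_iff[OF assms(2)] by blast
  then have ends: "mset (map fst p) = mset (map snd p)" using pcas_mset_ends[of u p u] by simp
  then have d': "distinct (map fst p)" using d by (metis mset_eq_imp_distinct_iff)
  have K: "card ?K = length (filter crosses p)"
    using d by (intro distinct_card distinct_filter) (simp add: distinct_map)
  have "fst ` ?K \<inter> snd ` ?K = {}"
  proof (rule ccontr)
    assume "fst ` ?K \<inter> snd ` ?K \<noteq> {}"
    then obtain v where "v \<in> fst ` ?K" "v \<in> snd ` ?K" by blast
    then obtain a b where ab: "a \<in> ?K" "b \<in> ?K" "snd a = fst b" by (elim imageE) simp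
    have conn: "a \<in> connecting_edges G f" if "a \<in> ?K" for a
    proof (rule crossing_arc_connecting)
      show "a \<in> parcs ?S" "crosses a" using that pS by auto
    qed
    have "(fst a, fst b) \<in> connecting_edges G f" using conn[OF ab(1)] by (simp flip: ab(3))
    moreover have "(fst b, snd b) \<in> connecting_edges G f" using conn[OF ab(2)] by simp
    ultimately have "fst a = snd b" by (rule connecting_edges_matching[OF assms(1,3)])
    then have "b = (snd a, fst a)" using ab(3) by (simp add: prod_eq_iff)
    then show False
      using ab(1,2) ucycle_no_rev[OF assms(2,4), of "fst a" "snd a"] by simp
  qed
  moreover have "inj_on fst ?K" "inj_on snd ?K"
    using d d' unfolding distinct_map by (blast intro: inj_on_subset[OF _ filter_is_subset])+
  ultimately have "2 * length (filter crosses p) = card (fst ` ?K \<union> snd ` ?K)"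
    by (simp add: card_Un_disjoint card_image K del: set_filter)
  also have "\<dots> \<le> card (set (map snd p))"
  proof (rule card_mono)
    have "set (map fst p) = set (map snd p)" using ends by (rule mset_eq_setD)
    then show "fst ` ?K \<union> snd ` ?K \<subseteq> set (map snd p)" by auto
  qed simp
  also have "\<dots> = length p" using distinct_card[OF d] by simp
  finally show ?thesis .
qed

section \<open>Transport of cycles along automorphisms and into the copies of
  \<open>H\<close>\<close>

lemma ucycle_map:
  assumes "pair_wf_digraph G" "\<phi> \<in> graph_auts G" "ucycle G p"
  shows "ucycle G (map (map_prod \<phi> \<phi>) p)"
proof -
  interpret pair_wf_digraph G by fact
  have p: "set p \<subseteq> parcs G" "distinct (map snd p)" "3 \<le> length p" and "\<exists>u. pcas u p u"
    using assms by (auto simp: ucycle_iff)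
  then obtain u where "pcas u p u" by blast
  then have "pcas (\<phi> u) (map (map_prod \<phi> \<phi>) p) (\<phi> u)" by (rule pcas_map)
  moreover have "set (map (map_prod \<phi> \<phi>) p) \<subseteq> parcs G"
  proof
    fix a assume "a \<in> set (map (map_prod \<phi> \<phi>) p)"
    then obtain x y where xy: "a = (\<phi> x, \<phi> y)" "(x, y) \<in> parcs G" using p(1) by auto
    then show "a \<in> parcs G"
      using assms(2) in_arcsD1[OF xy(2)] in_arcsD2[OF xy(2)] by (simp add: graph_auts_def)
  qed
  moreover have "distinct (map snd (map (map_prod \<phi> \<phi>) p))"
  proof -
    have "set (map snd p) \<subseteq> pverts G" using p(1) by (auto dest!: subsetD intro: in_arcsD2)
    moreover have "inj_on \<phi> (pverts G)"
      using assms(2) by (simp add: graph_auts_def Bij_def bij_betw_def)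
    ultimately have "inj_on \<phi> (set (map snd p))" by (rule inj_on_subset[rotated])
    then have "distinct (map \<phi> (map snd p))" using p(2) by (simp add: distinct_map comp_inj_on)
    then show ?thesis by (simp add: comp_def)
  qed
  ultimately show ?thesis using p(3) by (auto simp: ucycle_iff[OF assms(1)])
qed

lemma ucycle_copy:
  assumes "pair_wf_digraph H" "pair_wf_digraph (sierpinski_product G H f)"
    and "g \<in> pverts G" "ucycle H p"
  shows "ucycle (sierpinski_product G H f) (map (map_prod (Pair g) (Pair g)) p)"
proof -
  have p: "set p \<subseteq> parcs H" "distinct (map snd p)" "3 \<le> length p" and "\<exists>u. pcas u p u"
    using assms by (auto simp: ucycle_iff)
  then obtain u where "pcas u p u" by blast
  then have "pcas (g, u) (map (map_prod (Pair g) (Pair g)) p) (g, u)" by (rule pcas_map)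
  moreover have "distinct (map (Pair g) (map snd p))"
    using p(2) by (simp add: distinct_map inj_on_def del: map_map)
  moreover have "set (map (map_prod (Pair g) (Pair g)) p) \<subseteq> parcs (sierpinski_product G H f)"
    using p(1) assms(3) by (auto simp: parcs_sierpinski_product inner_edges_def)
  ultimately show ?thesis using p(3) by (auto simp: ucycle_iff[OF assms(2)] comp_def)
qed

lemma girth_le_length: "ucycle G p \<Longrightarrow> girth G \<le> enat (length p)"
  unfolding girth_def by (rule INF_lower) simp

text \<open>Keeps \<open>c\<close> away from 0, where the truncated subtraction in
  \<open>c - 1\<close> and \<open>2 * c - 1\<close> would not give a smaller number.\<close>

lemma three_le_girth: "3 \<le> girth G"
  unfolding girth_def by (rule INF_greatest) (auto simp: ucycle_def numeral_eq_enat)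

lemma girth_utree: "utree G \<Longrightarrow> girth G = \<infinity>"
  by (simp add: utree_def girth_def top_enat_def)

theorem theorem3p23:
  fixes G :: "'a pair_pre_digraph" and H :: "'b pair_pre_digraph"
    and f :: "'a \<Rightarrow> 'b" and c :: enat
  assumes "pair_bidirected_digraph G" and "pair_bidirected_digraph H"
    and "Digraph_Component.connected (with_proj G)"
    and "Digraph_Component.connected (with_proj H)"
    and "f \<in> pverts G \<rightarrow> pverts H"
    and "girth G = c"
    and "(utree G \<and> bridgeless H)
       \<or> edges_in_cycles_upto H (c - 1)
       \<or> (locally_injective G f \<and> edges_in_cycles_upto H (2 * c - 1))"
  shows "Aut_fundamental G H f = Aut (sierpinski_product G H f)"
proof -
  let ?S = "sierpinski_product G H f"
  interpret G: pair_bidirected_digraph G by fact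
  interpret H: pair_bidirected_digraph H by fact
  interpret S: pair_bidirected_digraph ?S
    by (rule pair_bidirected_digraph_sierpinski_product) fact+
  note wf = G.pair_wf_digraph_axioms H.pair_wf_digraph_axioms S.pair_wf_digraph_axioms
  have long: "c \<le> enat (length (filter crosses p))"
    if "ucycle ?S p" "e \<in> set p" "e \<in> connecting_edges G f" for p e
  proof -
    obtain r where "ucycle G r" "length r \<le> length (filter crosses p)"
      using ucycle_in_base[OF assms(1) wf(3) \<open>ucycle ?S p\<close> \<open>e \<in> set p\<close> \<open>e \<in> connecting_edges G f\<close>] .
    then show ?thesis using girth_le_length[of G r] \<open>girth G = c\<close>
      by (meson enat_ord_simps(1) order_trans assms(6))
  qed
  have c3: "3 \<le> c" using three_le_girth[of G] \<open>girth G = c\<close> by simp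
  \<comment> \<open>All cases reduce to one length bound \<open>b\<close>: every edge of
    \<open>H\<close> lies on a cycle that short, and no cycle of the product that short contains a
    connecting arc.\<close>
  obtain b where cyc: "edges_in_cycles_upto H b"
    and short: "\<And>p e. ucycle ?S p \<Longrightarrow> enat (length p) \<le> b \<Longrightarrow> e \<in> set p \<Longrightarrow> e \<notin> connecting_edges G f"
  proof -
    \<comment> \<open>For a tree \<open>c\<close> is \<open>\<infinity>\<close>, hence so is
      \<open>c - 1\<close>, and bridgelessness becomes the second case without any restriction on
      the length.\<close>
    consider (upto) "edges_in_cycles_upto H (c - 1)"
      | (inj) "locally_injective G f" "edges_in_cycles_upto H (2 * c - 1)"
      using assms(6,7) girth_utree[of G]
      by (auto simp: edges_in_cycles_upto_def bridgeless_def)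
    then show ?thesis
    proof cases
      case upto
      show ?thesis
      proof (rule that[OF upto])
        fix p e assume p: "ucycle ?S p" "enat (length p) \<le> c - 1" "e \<in> set p"
        show "e \<notin> connecting_edges G f"
        proof
          assume "e \<in> connecting_edges G f"
          then have "c \<le> enat (length (filter crosses p))" using long p by blast
          then have "c \<le> enat (length p)"
            by (meson enat_ord_simps(1) length_filter_le order_trans)
          \<comment> \<open>For infinite \<open>c\<close> the bound
            \<open>c \<le> enat (length p)\<close> is itself absurd; for finite \<open>c\<close> it
            contradicts length at most \<open>c - 1\<close>.\<close>
          then show False using p(2) c3
            by (cases c) (auto simp: one_enat_def numeral_eq_enat)
        qed
      qed
    next
      case inj
      show ?thesis
      proof (rule that[OF inj(2)])
        fix p e assume p: "ucycle ?S p" "enat (length p) \<le> 2 * c - 1" "e \<in> set p"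
        show "e \<notin> connecting_edges G f"
        proof
          assume "e \<in> connecting_edges G f"
          then have "c \<le> enat (length (filter crosses p))" using long p by blast
          moreover have "2 * length (filter crosses p) \<le> length p"
            by (rule twice_crossings_le_length[OF assms(1) wf(3) inj(1) p(1)])
          ultimately show False using p(2) c3
            by (cases c) (auto simp: one_enat_def numeral_eq_enat)
        qed
      qed
    qed
  qed
  have inner: "(\<phi> x, \<phi> y) \<in> inner_edges G H"
    if \<phi>: "\<phi> \<in> graph_auts ?S" and xy: "(x, y) \<in> inner_edges G H" for \<phi> x y
  proof -
    obtain g h h' where g: "x = (g, h)" "y = (g, h')" "g \<in> pverts G" "(h, h') \<in> parcs H"
      using xy by (auto simp: inner_edges_def)
    then obtain p where p: "ucycle H p" "(h, h') \<in> set p" "enat (length p) \<le> b"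
      using cyc by (auto simp: edges_in_cycles_upto_def)
    \<comment> \<open>The short cycle of \<open>H\<close> is copied into the fibre over
      \<open>g\<close> and then moved by \<open>\<phi>\<close>. Its length is unchanged, so the
      image contains no connecting arc.\<close>
    let ?p = "map (map_prod \<phi> \<phi>) (map (map_prod (Pair g) (Pair g)) p)"
    have "ucycle ?S ?p" by (intro ucycle_map ucycle_copy wf \<phi> g p)
    moreover have mem: "(\<phi> x, \<phi> y) \<in> set ?p"
      using p(2) by (force simp: g)
    ultimately have "(\<phi> x, \<phi> y) \<in> parcs ?S" "(\<phi> x, \<phi> y) \<notin> connecting_edges G f"
      using short[of ?p] p(3) wf(3) by (auto simp: ucycle_iff simp del: set_map)
    then show ?thesis by (simp add: parcs_sierpinski_product)
  qed
  have conn: "(\<phi> x, \<phi> y) \<in> connecting_edges G f"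
    if \<phi>: "\<phi> \<in> graph_auts ?S" and xy: "(x, y) \<in> connecting_edges G f" for \<phi> x y
  proof (rule ccontr)
    assume not_conn: "(\<phi> x, \<phi> y) \<notin> connecting_edges G f"
    have arc: "(x, y) \<in> parcs ?S" using xy by (simp add: parcs_sierpinski_product)
    then have V: "x \<in> pverts ?S" "y \<in> pverts ?S" by (auto dest: S.in_arcsD1 S.in_arcsD2)
    have bij: "\<phi> \<in> Bij (pverts ?S)" using \<phi> by (simp add: graph_auts_def)
    \<comment> \<open>If \<open>\<phi>\<close> sent a connecting arc to an inner one, its inverse
      would send an inner arc to a connecting one, against \<open>inner\<close> applied to the
      inverse.\<close>
    let ?\<psi> = "inv\<^bsub>BijGroup (pverts ?S)\<^esub> \<phi>"
    have \<psi>: "?\<psi> \<in> graph_auts ?S"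
      using subgroup.m_inv_closed[OF subgroup_graph_auts \<phi>] .
    have "?\<psi> (\<phi> z) = z" if "z \<in> pverts ?S" for z
      using that bij Bij_imp_funcset[OF bij]
      by (auto simp: inv_BijGroup[OF bij] Bij_def bij_betw_def)
    moreover have "(\<phi> x, \<phi> y) \<in> parcs ?S" using \<phi> arc V by (simp add: graph_auts_def)
    then have "(\<phi> x, \<phi> y) \<in> inner_edges G H"
      using not_conn by (simp add: parcs_sierpinski_product)
    then have "(?\<psi> (\<phi> x), ?\<psi> (\<phi> y)) \<in> inner_edges G H" by (rule inner[OF \<psi>])
    ultimately have "(x, y) \<in> inner_edges G H" using V by simp
    then show False
      using xy inner_edges_not_crosses connecting_edges_crosses[OF G.pair_loopfree_digraph_axioms]
      by blast
  qed
  have "{\<phi> \<in> graph_auts ?S. respects_fundamental_partition G H f \<phi>} = graph_auts ?S"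
    using inner conn by (auto simp: respects_fundamental_partition_def)
  then show ?thesis by (simp add: Aut_fundamental_def Aut_def)
qed

end
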